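(* Let $\mathbb{F}_q$ be any finite field, and let $M$ be any non-free, $\mathbb{F}_q$-representable matroid. If $m,n\in\mathbb{N}$ satisfy $m\geq n$, then $$\mathbb{P}_{A\sim[U_q]^{m\times n}}\{M \text{ is a minor of } M[A]\}\leq 1-\prod_{i=0}^{n-1}\left(1-q^{i-m}\right).$$
   Context: $\mathbb{F}_q$ is the finite field with $q$ elements. $[U_q]^{m\times n}$ denotes the uniform distribution on $\mathbb{F}_q^{m\times n}$ (entries i.i.d. uniform on $\mathbb{F}_q$), and $A \sim [U_q]^{m \times n}$ means that $A$ is drawn from it. For a matrix $A$ over $\mathbb{F}_q$ with $n$ columns, $M[A]$ is the column dependence matroid of $A$: its ground set is the set of column indices $\{1,\dots,n\}$, and a set of indices is independent iff the corresponding columns form a linearly independent family. All matroids are finite. A matroid is $\mathbb{F}_q$-representable if it is isomorphic to $M[A]$ for some matrix $A$ over $\mathbb{F}_q$. A matroid is free if every subset of its ground set is independent, and non-free otherwise. "$M$ is a minor of $N$" means that $M$ is isomorphic to a matroid obtained from $N$ by a sequence of deletions and contractions. *)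

theory Defs
  imports
    "HOL-Probability.Probability_Mass_Function"
    "Jordan_Normal_Form.DL_Rank"
begin

record 'a matroid =
  ground :: "'a set"
  indeps :: "'a set set"

locale finite_matroid =
  fixes M :: "'a matroid"
  assumes finite_ground: "finite (ground M)"
    and indeps_subset: "I \<in> indeps M \<Longrightarrow> I \<subseteq> ground M"
    and empty_indep: "{} \<in> indeps M"
    and indep_subset: "I \<in> indeps M \<Longrightarrow> J \<subseteq> I \<Longrightarrow> J \<in> indeps M"
    and augment: "I \<in> indeps M \<Longrightarrow> J \<in> indeps M \<Longrightarrow> card I < card J \<Longrightarrow>
      \<exists>x\<in>J - I. insert x I \<in> indeps M"

definition free_matroid :: "'a matroid \<Rightarrow> bool" where
  "free_matroid M \<longleftrightarrow> (\<forall>X. X \<subseteq> ground M \<longrightarrow> X \<in> indeps M)"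

definition matroid_iso :: "'a matroid \<Rightarrow> 'b matroid \<Rightarrow> bool" where
  "matroid_iso M N \<longleftrightarrow> (\<exists>f. bij_betw f (ground M) (ground N) \<and>
     (\<forall>X. X \<subseteq> ground M \<longrightarrow> (X \<in> indeps M \<longleftrightarrow> f ` X \<in> indeps N)))"

definition deletion :: "'a matroid \<Rightarrow> 'a set \<Rightarrow> 'a matroid" where
  "deletion M X = \<lparr>ground = ground M - X, indeps = {I \<in> indeps M. I \<subseteq> ground M - X}\<rparr>"

definition basis_of :: "'a matroid \<Rightarrow> 'a set \<Rightarrow> 'a set \<Rightarrow> bool" where
  "basis_of M X B \<longleftrightarrow> B \<subseteq> X \<and> B \<in> indeps M \<and>
     (\<forall>J. B \<subseteq> J \<and> J \<subseteq> X \<and> J \<in> indeps M \<longrightarrow> J = B)"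

text \<open>In a matroid the choice of the basis \<open>B\<close> of the contracted set is immaterial.\<close>

definition contraction :: "'a matroid \<Rightarrow> 'a set \<Rightarrow> 'a matroid" where
  "contraction M X = \<lparr>ground = ground M - X,
     indeps = {I. I \<subseteq> ground M - X \<and> (\<exists>B. basis_of M X B \<and> I \<union> B \<in> indeps M)}\<rparr>"

inductive del_contr_seq :: "'a matroid \<Rightarrow> 'a matroid \<Rightarrow> bool" for N where
  refl: "del_contr_seq N N"
| delete: "del_contr_seq N N' \<Longrightarrow> X \<subseteq> ground N' \<Longrightarrow> del_contr_seq N (deletion N' X)"
| contract: "del_contr_seq N N' \<Longrightarrow> X \<subseteq> ground N' \<Longrightarrow> del_contr_seq N (contraction N' X)"

definition is_minor :: "'a matroid \<Rightarrow> 'b matroid \<Rightarrow> bool" where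
  "is_minor M N \<longleftrightarrow> (\<exists>N'. del_contr_seq N N' \<and> matroid_iso M N')"

text \<open>
  The columns are a family: \<^const>\<open>inj_on\<close> is needed because two equal columns with distinct
  indices are dependent, while the library predicate only sees the set of columns.
  Column indices start at 0.
\<close>

definition column_matroid :: "'q::field mat \<Rightarrow> nat matroid" where
  "column_matroid A = \<lparr>ground = {..<dim_col A},
     indeps = {S. S \<subseteq> {..<dim_col A} \<and> inj_on (col A) S \<and>
       LinearCombinations.module.lin_indpt class_ring (module_vec TYPE('q) (dim_row A)) (col A ` S)}\<rparr>"

definition representable :: "'q::field itself \<Rightarrow> 'a matroid \<Rightarrow> bool" where
  "representable _ M \<longleftrightarrow> (\<exists>A :: 'q mat. matroid_iso M (column_matroid A))"

text \<open>The uniform distribution \<^const>\<open>pmf_of_set\<close> is only meaningful on a finite nonempty set.\<close>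

lemma finite_carrier_mat: "finite (carrier_mat m n :: 'q::finite mat set)"
proof -
  let ?I = "{..<m} \<times> {..<n}"
  have "(carrier_mat m n :: 'q mat set) \<subseteq> (\<lambda>f. mat m n f) ` (?I \<rightarrow>\<^sub>E UNIV)"
  proof
    fix A :: "'q mat" assume "A \<in> carrier_mat m n"
    then have "A = mat m n (restrict (\<lambda>ij. A $$ ij) ?I)"
      by (intro eq_matI) auto
    then show "A \<in> (\<lambda>f. mat m n f) ` (?I \<rightarrow>\<^sub>E UNIV)"
      by (rule image_eqI[where x = "restrict (\<lambda>ij. A $$ ij) ?I"]) (rule restrict_PiE_iff[THEN iffD2], simp)
  qed
  moreover have "finite (?I \<rightarrow>\<^sub>E (UNIV :: 'q set))"
    by (intro finite_PiE) auto
  ultimately show ?thesis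
    by (rule finite_subset[OF _ finite_imageI])
qed

lemma carrier_mat_nonempty: "(carrier_mat m n :: 'q::zero mat set) \<noteq> {}"
  using zero_carrier_mat[of m n] by force

definition uniform_mat :: "'q::{field,finite} itself \<Rightarrow> nat \<Rightarrow> nat \<Rightarrow> 'q mat pmf" where
  "uniform_mat _ m n = pmf_of_set (carrier_mat m n)"

end

theory Submission
  imports Defs
begin

text \<open>
  Deletion and contraction preserve freeness, so a non-free matroid is not a minor of \<open>M[A]\<close> when
  the columns of \<open>A\<close> are linearly independent. Adding the columns one at a time, each new column
  has to avoid the image of the previous ones, a set of at most \<open>q ^ i\<close> of the \<open>q ^ m\<close> vectors.
\<close>

section \<open>Freeness under deletion, contraction and isomorphism\<close>

lemma free_deletion: "free_matroid M \<Longrightarrow> free_matroid (deletion M X)"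
  by (auto simp: free_matroid_def deletion_def)

lemma free_contraction:
  assumes "free_matroid M" and "X \<subseteq> ground M"
  shows "free_matroid (contraction M X)"
proof -
  \<comment> \<open>In a free matroid the contracted set is independent, hence its own basis. Taking
    it as the witness for the existential in \<open>contraction\<close> reduces independence of
    \<open>Y\<close> to that of \<open>Y \<union> X\<close>, again a subset of the ground
    set.\<close>
  have "basis_of M X X"
    using assms by (auto simp: basis_of_def free_matroid_def)
  moreover have "Y \<union> X \<in> indeps M" if "Y \<subseteq> ground M - X" for Y
    using assms that by (simp add: free_matroid_def subset_iff)
  ultimately show ?thesis
    by (auto simp: free_matroid_def contraction_def)
qed

lemma free_del_contr_seq:
  assumes "del_contr_seq N N'" and "free_matroid N"
  shows "free_matroid N'"
  using assms by induction (auto intro: free_deletion free_contraction)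

lemma free_matroid_iso:
  assumes "matroid_iso M N" and "free_matroid N"
  shows "free_matroid M"
  unfolding free_matroid_def
proof (intro allI impI)
  fix X assume X: "X \<subseteq> ground M"
  from assms(1) obtain f where f: "bij_betw f (ground M) (ground N)"
    "\<forall>X. X \<subseteq> ground M \<longrightarrow> (X \<in> indeps M \<longleftrightarrow> f ` X \<in> indeps N)"
    by (auto simp: matroid_iso_def)
  have "f ` X \<subseteq> ground N"
    using f(1) X by (auto simp: bij_betw_def)
  then show "X \<in> indeps M"
    using f(2) X assms(2) by (auto simp: free_matroid_def)
qed

lemma free_minor: "is_minor M N \<Longrightarrow> free_matroid N \<Longrightarrow> free_matroid M"
  unfolding is_minor_def using free_del_contr_seq free_matroid_iso by blast

section \<open>Matrices with trivial kernel and their column matroids\<close>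

definition injective_mats :: "nat \<Rightarrow> nat \<Rightarrow> 'q::field mat set" where
  "injective_mats m n =
    {A \<in> carrier_mat m n. \<forall>v \<in> carrier_vec n. A *\<^sub>v v = 0\<^sub>v m \<longrightarrow> v = 0\<^sub>v n}"

lemma col_eq_mult_unit_vec:
  assumes "(A :: 'q::field mat) \<in> carrier_mat m n" and "j < n"
  shows "A *\<^sub>v unit_vec n j = col A j"
  using assms by (intro eq_vecI) auto

lemma mult_mat_vec_inj:
  assumes A: "A \<in> injective_mats m n"
    and v: "v \<in> carrier_vec n" and w: "w \<in> carrier_vec n"
    and eq: "A *\<^sub>v v = A *\<^sub>v w"
  shows "v = w"
proof -
  have A': "A \<in> carrier_mat m n"
    using A by (simp add: injective_mats_def)
  have "A *\<^sub>v (v - w) = 0\<^sub>v m"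
    using mult_minus_distrib_mat_vec[OF A' v w] eq A' w by auto
  then have "v - w = 0\<^sub>v n"
    using A v w by (auto simp: injective_mats_def)
  then have "v $ i = w $ i" if "i < n" for i
    using that v w by (metis carrier_vecD eq_iff_diff_eq_0 index_minus_vec(1) index_zero_vec(1))
  then show ?thesis
    using v w by (intro eq_vecI) auto
qed

text \<open>A trivial kernel yields both conditions in \<open>column_matroid\<close>. Equal columns
  with different indices would make two unit vectors have the same image, and a linear dependency
  among distinct columns is a nonzero kernel vector. Both conditions pass to subsets of the
  columns.\<close>

lemma free_column_matroid:
  fixes A :: "'q::field mat"
  assumes A: "A \<in> injective_mats m n"
  shows "free_matroid (column_matroid A)"
proof -
  interpret V: vec_space "TYPE('q)" m .
  have A': "A \<in> carrier_mat m n"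
    using A by (simp add: injective_mats_def)
  have inj: "inj_on (col A) {..<n}"
  proof (rule inj_onI)
    fix i j assume ij: "i \<in> {..<n}" "j \<in> {..<n}" "col A i = col A j"
    then have "unit_vec n i = (unit_vec n j :: 'q vec)"
      using mult_mat_vec_inj[OF A, of "unit_vec n i" "unit_vec n j"]
      by (simp add: col_eq_mult_unit_vec[OF A'])
    then show "i = j"
      using ij by (simp add: unit_vec_eq)
  qed
  have dist: "distinct (cols A)"
    using inj A' by (auto simp: cols_def distinct_map atLeast0LessThan)
  have indpt: "V.lin_indpt (set (cols A))"
  proof
    assume "V.lin_dep (set (cols A))"
    then obtain v where "v \<in> carrier_vec n" "v \<noteq> 0\<^sub>v n" "A *\<^sub>v v = 0\<^sub>v m"
      using V.lin_depE[OF A' _ dist] by blast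
    then show False
      using A by (simp add: injective_mats_def)
  qed
  have "V.lin_indpt (col A ` X)" if "X \<subseteq> {..<n}" for X
  proof (rule V.subset_li_is_li[OF indpt])
    show "col A ` X \<subseteq> set (cols A)"
      using that A' by (auto simp: cols_def)
  qed
  then show ?thesis
    using A' inj by (auto simp: free_matroid_def column_matroid_def intro: inj_on_subset)
qed

section \<open>Prepending a column, and the numbers of vectors and matrices\<close>

definition cons_col :: "'q vec \<Rightarrow> 'q mat \<Rightarrow> 'q mat" where
  "cons_col w A = mat (dim_row A) (Suc (dim_col A))
    (\<lambda>(i, j). case j of 0 \<Rightarrow> w $ i | Suc k \<Rightarrow> A $$ (i, k))"

lemma cons_col_carrier: "A \<in> carrier_mat m n \<Longrightarrow> cons_col w A \<in> carrier_mat m (Suc n)"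
  by (auto simp: cons_col_def)

text \<open>The inverse splits off column 0. The bijection gives the recursion for the number of all
  matrices, and its injectivity keeps extensions of injective matrices from being counted
  twice.\<close>

lemma bij_betw_cons_col:
  "bij_betw (\<lambda>(w, A). cons_col w A) (carrier_vec m \<times> carrier_mat m n) (carrier_mat m (Suc n))"
proof (rule bij_betw_byWitness[where f' = "\<lambda>B. (col B 0, mat m n (\<lambda>(i, j). B $$ (i, Suc j)))"])
  show "\<forall>B \<in> carrier_mat m (Suc n).
    (\<lambda>(w, A). cons_col w A) (col B 0, mat m n (\<lambda>(i, j). B $$ (i, Suc j))) = B"
    by (auto intro!: eq_matI simp: cons_col_def split: nat.split)
qed (auto intro!: eq_matI eq_vecI simp: cons_col_def)

lemma bij_betw_vCons:
  "bij_betw (\<lambda>(a, v). vCons a v) (UNIV \<times> carrier_vec n) (carrier_vec (Suc n))"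
  unfolding bij_betw_def
proof
  show "inj_on (\<lambda>(a, v). vCons a v) (UNIV \<times> carrier_vec n)"
    by (auto simp: inj_on_def)
  have "w \<in> (\<lambda>(a, v). vCons a v) ` (UNIV \<times> carrier_vec n)"
    if "w \<in> carrier_vec (Suc n)" for w :: "'a vec"
    using that by (cases w) (auto simp del: carrier_vec_dim_vec intro!: image_eqI)
  then show "(\<lambda>(a, v). vCons a v) ` (UNIV \<times> carrier_vec n) = (carrier_vec (Suc n) :: 'a vec set)"
    by auto
qed

lemma card_carrier_vec: "card (carrier_vec n :: 'q::finite vec set) = CARD('q) ^ n"
proof (induction n)
  case 0
  have "(carrier_vec 0 :: 'q vec set) = {vNil}"
    by auto
  then show ?case
    by simp
next
  case (Suc n)
  then show ?case
    using bij_betw_same_card[OF bij_betw_vCons[where ?'a = 'q and n = n]]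
    by (simp add: card_cartesian_product)
qed

lemma finite_carrier_vec: "finite (carrier_vec n :: 'q::finite vec set)"
  by (rule card_ge_0_finite) (simp add: card_carrier_vec)

lemma card_carrier_mat_Suc:
  "card (carrier_mat m (Suc n) :: 'q::finite mat set) = CARD('q) ^ m * card (carrier_mat m n :: 'q mat set)"
  using bij_betw_same_card[OF bij_betw_cons_col[where ?'a = 'q and m = m and n = n]]
  by (simp add: card_cartesian_product card_carrier_vec)

text \<open>This is why the new column goes in front: its coefficient is then the head of the
  vector, so \<open>vCons\<close> on vectors matches \<open>cons_col\<close> on matrices.\<close>

lemma cons_col_mult_vCons:
  fixes A :: "'q::field mat"
  assumes "A \<in> carrier_mat m n" and "w \<in> carrier_vec m" and "v \<in> carrier_vec n"
  shows "cons_col w A *\<^sub>v vCons a v = a \<cdot>\<^sub>v w + A *\<^sub>v v"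
proof (rule eq_vecI)
  fix i assume "i < dim_vec (a \<cdot>\<^sub>v w + A *\<^sub>v v)"
  then have i: "i < m"
    using assms by simp
  then have "row (cons_col w A) i = vCons (w $ i) (row A i)"
    using assms by (auto intro!: eq_vecI simp: cons_col_def vec_index_vCons split: nat.split)
  then show "(cons_col w A *\<^sub>v vCons a v) $ i = (a \<cdot>\<^sub>v w + A *\<^sub>v v) $ i"
    using i assms cons_col_carrier[OF assms(1), of w] by simp
qed (use assms in \<open>simp add: cons_col_def\<close>)

text \<open>Let \<open>vCons a v\<close> be in the kernel of the extended matrix. If
  \<open>a\<close> were nonzero, solving for \<open>w\<close> would put it in the image of
  \<open>A\<close>. So \<open>a\<close> is 0, and \<open>v\<close> lies in the trivial kernel of
  \<open>A\<close>.\<close>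

lemma cons_col_injective:
  fixes A :: "'q::field mat"
  assumes A: "A \<in> injective_mats m n"
    and w: "w \<in> carrier_vec m" "w \<notin> (\<lambda>v. A *\<^sub>v v) ` carrier_vec n"
  shows "cons_col w A \<in> injective_mats m (Suc n)"
proof -
  have A': "A \<in> carrier_mat m n"
    using A by (simp add: injective_mats_def)
  have "u = 0\<^sub>v (Suc n)"
    if u: "u \<in> carrier_vec (Suc n)" and zero: "cons_col w A *\<^sub>v u = 0\<^sub>v m" for u
  proof -
    obtain a v where uv: "u = vCons a v" "v \<in> carrier_vec n"
      using u by (cases u) auto
    have eq: "a \<cdot>\<^sub>v w + A *\<^sub>v v = 0\<^sub>v m"
      using zero cons_col_mult_vCons[OF A' w(1) uv(2), of a] uv(1) by simp
    have "a = 0"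
    proof (rule ccontr)
      assume a: "a \<noteq> 0"
      have "w = A *\<^sub>v (- inverse a \<cdot>\<^sub>v v)"
      proof (rule eq_vecI)
        fix i assume "i < dim_vec (A *\<^sub>v (- inverse a \<cdot>\<^sub>v v))"
        then have i: "i < m"
          using A' by simp
        have "a * w $ i + (A *\<^sub>v v) $ i = 0"
          using arg_cong[OF eq, of "\<lambda>x. x $ i"] i w(1) A' by simp
        then have "w $ i = - inverse a * (A *\<^sub>v v) $ i"
          using a by (simp add: field_simps eq_neg_iff_add_eq_0)
        then show "w $ i = (A *\<^sub>v (- inverse a \<cdot>\<^sub>v v)) $ i"
          using i A' uv(2) by (simp add: mult_mat_vec[OF A' uv(2)])
      qed (use w A' in simp)
      then show False
        using w(2) uv(2) by auto
    qed
    moreover have "0 \<cdot>\<^sub>v w = 0\<^sub>v m"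
      using w(1) by (intro eq_vecI) auto
    ultimately have "A *\<^sub>v v = 0\<^sub>v m"
      using eq A' uv(2) by (simp add: left_zero_vec[of _ m])
    then have "v = 0\<^sub>v n"
      using A uv(2) by (simp add: injective_mats_def)
    then show ?thesis
      using uv(1) \<open>a = 0\<close> by (simp add: zero_vec_Suc)
  qed
  then show ?thesis
    using cons_col_carrier[OF A'] by (simp add: injective_mats_def)
qed

section \<open>Proportion of injective matrices\<close>

lemma finite_injective_mats: "finite (injective_mats m n :: 'q::{field,finite} mat set)"
  by (rule finite_subset[OF _ finite_carrier_mat[of m n]]) (auto simp: injective_mats_def)

text \<open>Every injective \<open>A\<close> can be extended by any vector outside its image, which
  has at most \<open>CARD('q) ^ n\<close> elements, and different pairs of \<open>A\<close> and
  \<open>w\<close> give different matrices. The subtraction is on natural numbers, so for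
  \<open>n > m\<close> the left side is 0.\<close>

lemma card_injective_mats_Suc:
  "card (injective_mats m n :: 'q::{field,finite} mat set) * (CARD('q) ^ m - CARD('q) ^ n)
    \<le> card (injective_mats m (Suc n) :: 'q mat set)"
proof -
  let ?W = "\<lambda>A :: 'q mat. carrier_vec m - (\<lambda>v. A *\<^sub>v v) ` carrier_vec n"
  let ?S = "SIGMA A : injective_mats m n. ?W A"
  have W: "CARD('q) ^ m - CARD('q) ^ n \<le> card (?W A)" for A
  proof -
    have "card ((\<lambda>v. A *\<^sub>v v) ` carrier_vec n) \<le> CARD('q) ^ n"
      using card_image_le[OF finite_carrier_vec] by (metis card_carrier_vec)
    then show ?thesis
      using diff_card_le_card_Diff[of "(\<lambda>v. A *\<^sub>v v) ` carrier_vec n" "carrier_vec m"]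
      by (simp add: card_carrier_vec finite_carrier_vec)
  qed
  have "card (injective_mats m n :: 'q mat set) * (CARD('q) ^ m - CARD('q) ^ n)
    \<le> (\<Sum>A \<in> injective_mats m n. card (?W A))"
    using sum_bounded_below[of "injective_mats m n" _ "\<lambda>A. card (?W A)"] W by simp
  also have "\<dots> = card ?S"
    by (simp add: card_SigmaI finite_injective_mats finite_carrier_vec)
  also have "\<dots> \<le> card (injective_mats m (Suc n) :: 'q mat set)"
  proof (rule card_inj_on_le[OF _ _ finite_injective_mats])
    have "inj_on (\<lambda>(w, A). cons_col w A) (carrier_vec m \<times> (carrier_mat m n :: 'q mat set))"
      using bij_betw_cons_col by (rule bij_betw_imp_inj_on)
    then show "inj_on (\<lambda>(A, w). cons_col w A) ?S"
      unfolding inj_on_def injective_mats_def by auto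
    show "(\<lambda>(A, w). cons_col w A) ` ?S \<subseteq> injective_mats m (Suc n)"
      by (auto intro: cons_col_injective)
  qed
  finally show ?thesis .
qed

lemma injective_mats_density:
  assumes "n \<le> m"
  shows "(\<Prod>i<n. 1 - real CARD('q::{field,finite}) powi (int i - int m))
    \<le> card (injective_mats m n :: 'q mat set) / card (carrier_mat m n :: 'q mat set)"
  using assms
proof (induction n)
  case 0
  \<comment> \<open>The only vector of length 0 is the zero vector, so the proportion is 1, the
    value of the empty product.\<close>
  have "(injective_mats m 0 :: 'q mat set) = carrier_mat m 0"
    by (auto simp: injective_mats_def)
  then show ?case
    using finite_carrier_mat[of m 0, where ?'q = 'q] carrier_mat_nonempty[of m 0, where ?'q = 'q]
    by simp
next
  case (Suc n)
  let ?q = "real CARD('q)"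
  let ?F = "\<lambda>n. card (injective_mats m n :: 'q mat set)"
  let ?C = "\<lambda>n. card (carrier_mat m n :: 'q mat set)"
  have q: "?q \<ge> 1"
    using zero_less_card_finite[where 'a = 'q] by linarith
  have le: "CARD('q) ^ n \<le> CARD('q) ^ m"
    using Suc.prems by (intro power_increasing) (auto simp: Suc_le_eq)
  \<comment> \<open>By \<open>le\<close> the truncated difference is the true one. Written as a
    quotient of a cast natural number, the factor is visibly nonnegative, as
    \<open>mult_right_mono\<close> requires. It is the proportion of vectors left for the new column
    when \<open>CARD('q) ^ n\<close> of them are excluded.\<close>
  have factor: "1 - ?q powi (int n - int m) = real (CARD('q) ^ m - CARD('q) ^ n) / ?q ^ m"
    using q le by (simp add: power_int_diff of_nat_diff diff_divide_distrib)
  have "(\<Prod>i<Suc n. 1 - ?q powi (int i - int m))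
    \<le> ?F n / ?C n * (real (CARD('q) ^ m - CARD('q) ^ n) / ?q ^ m)"
    unfolding prod.lessThan_Suc factor using Suc by (intro mult_right_mono) auto
  also have "\<dots> = real (?F n * (CARD('q) ^ m - CARD('q) ^ n)) / ?C (Suc n)"
    by (simp add: card_carrier_mat_Suc mult.commute)
  also have "\<dots> \<le> ?F (Suc n) / ?C (Suc n)"
    by (intro divide_right_mono) (simp_all only: of_nat_le_iff of_nat_0_le_iff card_injective_mats_Suc)
  finally show ?case .
qed

theorem theorem4:
  fixes M :: "'a matroid" and m n :: nat
  assumes "finite_matroid M"
    and "\<not> free_matroid M"
    and "representable TYPE('q::{field,finite}) M"
    and "m \<ge> n"
  shows "measure_pmf.prob (uniform_mat TYPE('q) m n) {A. is_minor M (column_matroid A)}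
    \<le> 1 - (\<Prod>i<n. 1 - real CARD('q) powi (int i - int m))"
proof -
  let ?P = "uniform_mat TYPE('q) m n"
  \<comment> \<open>If \<open>A\<close> is injective, its column matroid is free and so is every
    minor of it. As \<open>M\<close> is not free, the event lies in the complement of
    \<open>injective_mats m n\<close>. That complement also contains matrices of other dimensions,
    which have probability 0 under \<open>?P\<close>.\<close>
  have "measure_pmf.prob ?P {A. is_minor M (column_matroid A)}
    \<le> measure_pmf.prob ?P (- injective_mats m n)"
    using assms(2) by (intro measure_pmf.finite_measure_mono) (auto dest: free_minor free_column_matroid)
  also have "\<dots> = 1 - measure_pmf.prob ?P (injective_mats m n)"
    using measure_pmf.prob_compl[of "injective_mats m n" ?P] by (simp add: Compl_eq_Diff_UNIV)
  also have "measure_pmf.prob ?P (injective_mats m n) =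
    card (injective_mats m n :: 'q mat set) / card (carrier_mat m n :: 'q mat set)"
  proof -
    have "carrier_mat m n \<inter> injective_mats m n = (injective_mats m n :: 'q mat set)"
      by (auto simp: injective_mats_def)
    then show ?thesis
      by (simp add: uniform_mat_def measure_pmf_of_set[OF carrier_mat_nonempty finite_carrier_mat])
  qed
  finally show ?thesis
    using injective_mats_density[OF assms(4), where ?'q = 'q] by linarith
qed

end
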